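(* Let $v\ge1$, $n=2^v$, and let $\xi\in\mathbf{K}[\![v,1]\!]$ be a characteristic minmatrix with $\xi\ne\emptyset$. Then: (DR1) $\xi$ includes at least one of $\mathrm{Vv}_0$ or $\mathrm{Dd}_0$; (DR2) for $1\le k<n$, $\xi$ includes $\mathrm{Dw}_k$ only if it includes $\mathrm{Dd}_0$ and all $\mathrm{Dw}_l$ with $1\le l<k$; (DR3) for $1\le k<n$, $\xi$ includes $\mathrm{Dc}_k$ only if it includes $\mathrm{Dd}_0$, all $\mathrm{Dw}_l$ with $1\le l<k$, and all $\mathrm{Dc}_l$ with $1\le l<k$. (Here "includes" means inclusion as a subset of minterms.)
   Context: $m_0,\dots,m_{n-1}$ enumerate the $n=2^v$ Boolean minterms $\bigwedge_{k=0}^{v-1}\pm p_k$; $\Diamond^1m_i=\Diamond m_i$, $\Diamond^0m_i=\neg\Diamond m_i$. $\mathbf{K}[v,1]$ is the Lindenbaum–Tarski algebra (modulo provable equivalence in the least normal modal logic $\mathbf{K}$) of formulas in $p_0,\dots,p_{v-1}$ of modal degree $\le1$; its atoms (minterms) are the formulas $m_s\wedge\bigwedge_{i=0}^{n-1}\Diamond^{\varepsilon_i}m_i$ ($0\le s<n$, $\varepsilon\in\{0,1\}^n$), and each element $\varphi$ is identified with its set $[\varphi]$ of minterms. For a normal modal logic $\mathbf{S}$ (normal extension of $\mathbf{K}$), $[\![\mathbf{S}]\!]=\bigcap\{[\varphi]:\varphi\in\mathbf{K}[v,1],\ \mathbf{S}\vdash\varphi\}$, and $\mathbf{K}[\![v,1]\!]$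 is the set of all such characteristic minmatrices (the inconsistent logic gives $\emptyset$). The following sets of minterms (with $s$ ranging over $0,\dots,n-1$) are defined: $\mathrm{Vv}_0$: all $\varepsilon_i=0$; $\mathrm{Dd}_0$: $\varepsilon_s=1$, $\varepsilon_i=0$ for $i\ne s$; $\mathrm{Dc}_k$ ($1\le k<n$): $\varepsilon_s=0$ and exactly $k$ indices $i\ne s$ with $\varepsilon_i=1$; $\mathrm{Dw}_k$ ($1\le k<n$): $\varepsilon_s=1$ and exactly $k$ indices $i\ne s$ with $\varepsilon_i=1$. *)

theory Defs
  imports Main
begin

datatype fm = Bot | Var nat | Imp fm fm | Box fm

definition Neg :: "fm \<Rightarrow> fm" where "Neg \<phi> = Imp \<phi> Bot"
definition Top :: fm where "Top = Neg Bot"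
definition And :: "fm \<Rightarrow> fm \<Rightarrow> fm" where "And \<phi> \<psi> = Neg (Imp \<phi> (Neg \<psi>))"
definition Iff :: "fm \<Rightarrow> fm \<Rightarrow> fm" where "Iff \<phi> \<psi> = And (Imp \<phi> \<psi>) (Imp \<psi> \<phi>)"
definition Dia :: "fm \<Rightarrow> fm" where "Dia \<phi> = Neg (Box (Neg \<phi>))"
definition BigAnd :: "fm list \<Rightarrow> fm" where "BigAnd \<phi>s = foldr And \<phi>s Top"

fun vars :: "fm \<Rightarrow> nat set" where
  "vars Bot = {}"
| "vars (Var k) = {k}"
| "vars (Imp \<phi> \<psi>) = vars \<phi> \<union> vars \<psi>"
| "vars (Box \<phi>) = vars \<phi>"

fun mdeg :: "fm \<Rightarrow> nat" where
  "mdeg Bot = 0"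
| "mdeg (Var k) = 0"
| "mdeg (Imp \<phi> \<psi>) = max (mdeg \<phi>) (mdeg \<psi>)"
| "mdeg (Box \<phi>) = Suc (mdeg \<phi>)"

fun subst :: "(nat \<Rightarrow> fm) \<Rightarrow> fm \<Rightarrow> fm" where
  "subst \<sigma> Bot = Bot"
| "subst \<sigma> (Var k) = \<sigma> k"
| "subst \<sigma> (Imp \<phi> \<psi>) = Imp (subst \<sigma> \<phi>) (subst \<sigma> \<psi>)"
| "subst \<sigma> (Box \<phi>) = Box (subst \<sigma> \<phi>)"

text \<open>Propositional evaluation: variables and boxed formulas are both treated as
  propositional atoms, valued by \<open>V\<close> and \<open>W\<close> respectively.\<close>

fun peval :: "(nat \<Rightarrow> bool) \<Rightarrow> (fm \<Rightarrow> bool) \<Rightarrow> fm \<Rightarrow> bool" where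
  "peval V W Bot = False"
| "peval V W (Var k) = V k"
| "peval V W (Imp \<phi> \<psi>) = (peval V W \<phi> \<longrightarrow> peval V W \<psi>)"
| "peval V W (Box \<phi>) = W \<phi>"

definition tautology :: "fm \<Rightarrow> bool" where
  "tautology \<phi> \<longleftrightarrow> (\<forall>V W. peval V W \<phi>)"

definition normal_logic :: "fm set \<Rightarrow> bool" where
  "normal_logic S \<longleftrightarrow>
     (\<forall>\<phi>. tautology \<phi> \<longrightarrow> \<phi> \<in> S) \<and>
     (\<forall>\<phi> \<psi>. Imp (Box (Imp \<phi> \<psi>)) (Imp (Box \<phi>) (Box \<psi>)) \<in> S) \<and>
     (\<forall>\<phi> \<psi>. Imp \<phi> \<psi> \<in> S \<longrightarrow> \<phi> \<in> S \<longrightarrow> \<psi> \<in> S) \<and>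
     (\<forall>\<phi>. \<phi> \<in> S \<longrightarrow> Box \<phi> \<in> S) \<and>
     (\<forall>\<phi> \<sigma>. \<phi> \<in> S \<longrightarrow> subst \<sigma> \<phi> \<in> S)"

definition K :: "fm set" where
  "K = \<Inter> {S. normal_logic S}"

definition Fm :: "nat \<Rightarrow> nat \<Rightarrow> fm set" where
  "Fm v d = {\<phi>. vars \<phi> \<subseteq> {..<v} \<and> mdeg \<phi> \<le> d}"

definition K_equiv :: "nat \<Rightarrow> nat \<Rightarrow> (fm \<times> fm) set" where
  "K_equiv v d = {(\<phi>, \<psi>). \<phi> \<in> Fm v d \<and> \<psi> \<in> Fm v d \<and> Iff \<phi> \<psi> \<in> K}"

text \<open>Lindenbaum--Tarski algebra (carrier), its order, and provability of
  its elements in a normal logic; the last two do not depend on the representatives.\<close>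

definition K_alg :: "nat \<Rightarrow> nat \<Rightarrow> fm set set" where
  "K_alg v d = Fm v d // K_equiv v d"

definition alg_le :: "fm set \<Rightarrow> fm set \<Rightarrow> bool" where
  "alg_le a b \<longleftrightarrow> (\<exists>\<phi>\<in>a. \<exists>\<psi>\<in>b. Imp \<phi> \<psi> \<in> K)"

definition provable :: "fm set \<Rightarrow> fm set \<Rightarrow> bool" where
  "provable S a \<longleftrightarrow> (\<exists>\<phi>\<in>a. \<phi> \<in> S)"

text \<open>The Boolean minterms are enumerated by binary expansion of the index: \<open>p\<^sub>k\<close> occurs
  positively in the \<open>i\<close>-th one iff the \<open>k\<close>-th binary digit of \<open>i\<close> is 1 (for \<open>i < 2 ^ v\<close>).\<close>

definition bool_minterm :: "nat \<Rightarrow> nat \<Rightarrow> fm" where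
  "bool_minterm v i = BigAnd (map (\<lambda>k. if bit i k then Var k else Neg (Var k)) [0..<v])"

definition minterm_fm :: "nat \<Rightarrow> nat \<Rightarrow> (nat \<Rightarrow> bool) \<Rightarrow> fm" where
  "minterm_fm v s \<epsilon> =
     And (bool_minterm v s)
         (BigAnd (map (\<lambda>i. if \<epsilon> i then Dia (bool_minterm v i) else Neg (Dia (bool_minterm v i)))
                      [0..<2 ^ v]))"

text \<open>Only the values \<open>\<epsilon> i\<close> with \<open>i < 2 ^ v\<close> matter in the following.\<close>

definition minterm :: "nat \<Rightarrow> nat \<Rightarrow> (nat \<Rightarrow> bool) \<Rightarrow> fm set" where
  "minterm v s \<epsilon> = K_equiv v 1 `` {minterm_fm v s \<epsilon>}"

definition minterms :: "nat \<Rightarrow> fm set set" where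
  "minterms v = {minterm v s \<epsilon> | s \<epsilon>. s < 2 ^ v}"

definition minset :: "nat \<Rightarrow> fm set \<Rightarrow> fm set set" where
  "minset v a = {m \<in> minterms v. alg_le m a}"

definition char_minmatrix :: "nat \<Rightarrow> fm set \<Rightarrow> fm set set" where
  "char_minmatrix v S = \<Inter> {minset v a | a. a \<in> K_alg v 1 \<and> provable S a}"

definition char_minmatrices :: "nat \<Rightarrow> fm set set set" where
  "char_minmatrices v = {char_minmatrix v S | S. normal_logic S}"

definition Vv0 :: "nat \<Rightarrow> fm set set" where
  "Vv0 v = {minterm v s \<epsilon> | s \<epsilon>. s < 2 ^ v \<and> (\<forall>i<2 ^ v. \<not> \<epsilon> i)}"

definition Dd0 :: "nat \<Rightarrow> fm set set" where
  "Dd0 v = {minterm v s \<epsilon> | s \<epsilon>. s < 2 ^ v \<and> \<epsilon> s \<and> (\<forall>i<2 ^ v. i \<noteq> s \<longrightarrow> \<not> \<epsilon> i)}"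

definition Dc :: "nat \<Rightarrow> nat \<Rightarrow> fm set set" where
  "Dc v k = {minterm v s \<epsilon> | s \<epsilon>. s < 2 ^ v \<and> \<not> \<epsilon> s \<and> card {i. i < 2 ^ v \<and> i \<noteq> s \<and> \<epsilon> i} = k}"

definition Dw :: "nat \<Rightarrow> nat \<Rightarrow> fm set set" where
  "Dw v k = {minterm v s \<epsilon> | s \<epsilon>. s < 2 ^ v \<and> \<epsilon> s \<and> card {i. i < 2 ^ v \<and> i \<noteq> s \<and> \<epsilon> i} = k}"

end

theory Submission
  imports Defs
begin

text \<open>A minterm \<open>(s, \<epsilon>)\<close> describes a Kripke model of depth one: a root with valuation \<open>s\<close>, seeing
  exactly the valuations in \<open>E = {i. \<epsilon> i}\<close>. A minterm lies in the characteristic minmatrix of \<open>S\<close>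
  iff all theorems of \<open>S\<close> in \<open>v\<close> variables of degree at most one hold at the root of its model.
  Every map \<open>f\<close> on valuations is induced by a substitution of Boolean formulas, so, \<open>S\<close>
  being closed under substitution, membership passes from \<open>(s', E')\<close> to \<open>(f s', f ` E')\<close>.
  All three diagonal rules are instances, for suitable surjections \<open>f\<close>.\<close>

section \<open>Kripke semantics\<close>

fun holds :: "('w \<Rightarrow> 'w \<Rightarrow> bool) \<Rightarrow> ('w \<Rightarrow> nat \<Rightarrow> bool) \<Rightarrow> 'w \<Rightarrow> fm \<Rightarrow> bool" where
  "holds R V w Bot = False"
| "holds R V w (Var k) = V w k"
| "holds R V w (Imp \<phi> \<psi>) = (holds R V w \<phi> \<longrightarrow> holds R V w \<psi>)"
| "holds R V w (Box \<phi>) = (\<forall>u. R w u \<longrightarrow> holds R V u \<phi>)"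

lemma holds_simps [simp]:
  "holds R V w (Neg \<phi>) \<longleftrightarrow> \<not> holds R V w \<phi>"
  "holds R V w (And \<phi> \<psi>) \<longleftrightarrow> holds R V w \<phi> \<and> holds R V w \<psi>"
  "holds R V w (Dia \<phi>) \<longleftrightarrow> (\<exists>u. R w u \<and> holds R V u \<phi>)"
  "holds R V w (BigAnd \<phi>s) \<longleftrightarrow> (\<forall>\<phi>\<in>set \<phi>s. holds R V w \<phi>)"
  by (induction \<phi>s) (auto simp: Neg_def And_def Dia_def BigAnd_def Top_def)

lemma peval_simps [simp]:
  "peval V W (Neg \<phi>) \<longleftrightarrow> \<not> peval V W \<phi>"
  "peval V W (And \<phi> \<psi>) \<longleftrightarrow> peval V W \<phi> \<and> peval V W \<psi>"
  "peval V W (Iff \<phi> \<psi>) \<longleftrightarrow> (peval V W \<phi> \<longleftrightarrow> peval V W \<psi>)"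
  "peval V W (Dia \<phi>) \<longleftrightarrow> \<not> W (Neg \<phi>)"
  "peval V W (BigAnd \<phi>s) \<longleftrightarrow> (\<forall>\<phi>\<in>set \<phi>s. peval V W \<phi>)"
  by (induction \<phi>s) (auto simp: Neg_def And_def Iff_def Dia_def BigAnd_def Top_def)

lemma peval_foldr_Imp [simp]:
  "peval V W (foldr Imp \<phi>s \<psi>) \<longleftrightarrow> ((\<forall>\<phi>\<in>set \<phi>s. peval V W \<phi>) \<longrightarrow> peval V W \<psi>)"
  by (induction \<phi>s) auto

text \<open>From a single world, boxed subformulas look like propositional atoms, so tautologies
  hold at every world.\<close>

lemma holds_eq_peval:
  "holds R V w \<phi> = peval (V w) (\<lambda>\<psi>. \<forall>u. R w u \<longrightarrow> holds R V u \<psi>) \<phi>"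
  by (induction \<phi>) auto

lemma holds_subst:
  "holds R V w (subst \<sigma> \<phi>) = holds R (\<lambda>u k. holds R V u (\<sigma> k)) w \<phi>"
  by (induction \<phi> arbitrary: w) auto

lemma holds_bool_eq_peval:
  assumes "mdeg \<phi> = 0" "vars \<phi> \<subseteq> A" "\<And>k. k \<in> A \<Longrightarrow> V w k = U k"
  shows "holds R V w \<phi> = peval U W \<phi>"
  using assms by (induction \<phi>) auto

text \<open>Quantifying over all valuations of the frame gives closure under substitution. As
  \<open>K\<close> is the intersection of all normal logics, its soundness follows without induction
  on derivations.\<close>

lemma normal_logic_of_frame: "normal_logic {\<phi>. \<forall>V w. holds R V w \<phi>}"
  unfolding normal_logic_def tautology_def
  by (auto simp: holds_subst) (metis holds_eq_peval)

lemma K_sound: "\<phi> \<in> K \<Longrightarrow> holds R V w \<phi>"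
  using normal_logic_of_frame[of R] unfolding K_def by blast

section \<open>Derivations in normal logics\<close>

lemma normal_logic_K: "normal_logic K"
  unfolding K_def normal_logic_def by blast

lemma normal_logic_mp: "normal_logic S \<Longrightarrow> Imp \<phi> \<psi> \<in> S \<Longrightarrow> \<phi> \<in> S \<Longrightarrow> \<psi> \<in> S"
  unfolding normal_logic_def by blast

lemma normal_logic_taut: "normal_logic S \<Longrightarrow> (\<And>V W. peval V W \<phi>) \<Longrightarrow> \<phi> \<in> S"
  unfolding normal_logic_def tautology_def by blast

lemma normal_logic_foldr_mp:
  assumes "normal_logic S" "foldr Imp \<phi>s \<psi> \<in> S" "set \<phi>s \<subseteq> S"
  shows "\<psi> \<in> S"
  using assms(2,3) by (induction \<phi>s) (auto dest: normal_logic_mp[OF assms(1)])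

text \<open>Propositional reasoning inside a logic is replaced by a semantic check: the chain of
  implications from the premises is a tautology, and modus ponens removes the premises one by
  one.\<close>

lemma normal_logic_taut_conseq:
  assumes "normal_logic S" "set \<phi>s \<subseteq> S"
    and "\<And>V W. \<forall>\<phi>\<in>set \<phi>s. peval V W \<phi> \<Longrightarrow> peval V W \<psi>"
  shows "\<psi> \<in> S"
proof -
  have "tautology (foldr Imp \<phi>s \<psi>)"
    using assms(3) by (auto simp: tautology_def)
  then show ?thesis
    using assms normal_logic_foldr_mp unfolding normal_logic_def by blast
qed

text \<open>Necessitation followed by repeated distribution of \<open>Box\<close>. The list is taken
  apart from its end, because the last premise can be absorbed into the conclusion
  \<open>\<psi>\<close>.\<close>

lemma normal_logic_Box_foldr_Imp:
  assumes S: "normal_logic S" and "foldr Imp \<phi>s \<psi> \<in> S"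
  shows "foldr Imp (map Box \<phi>s) (Box \<psi>) \<in> S"
  using assms(2)
proof (induction \<phi>s arbitrary: \<psi> rule: rev_induct)
  case Nil
  then show ?case using S by (simp add: normal_logic_def)
next
  case (snoc \<phi> \<phi>s)
  let ?L = "foldr Imp (map Box \<phi>s) (Box (Imp \<phi> \<psi>))"
  let ?A = "Imp (Box (Imp \<phi> \<psi>)) (Imp (Box \<phi>) (Box \<psi>))"
  have "?L \<in> S" using snoc by simp
  moreover have "?A \<in> S" using S by (simp add: normal_logic_def)
  ultimately show ?case
    by (intro normal_logic_taut_conseq[OF S, of "[?L, ?A]"]) auto
qed

section \<open>Boolean minterms\<close>

lemma bit_nat_ge_False:
  fixes i :: nat
  assumes "i < 2 ^ v" "v \<le> k"
  shows "\<not> bit i k"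
  using assms by (metis bit_take_bit_iff linorder_not_less take_bit_nat_eq_self)

lemma bits_eq_iff:
  fixes i j :: nat
  assumes "i < 2 ^ v" "j < 2 ^ v"
  shows "(\<forall>k<v. bit i k = bit j k) \<longleftrightarrow> i = j"
  using bit_nat_ge_False[OF assms(1)] bit_nat_ge_False[OF assms(2)]
  by (metis bit_eqI linorder_not_less)

text \<open>The Boolean minterms are exhaustive: the index is the number whose binary digits are the
  values of \<open>U\<close>.\<close>

lemma ex_nat_with_bits: "\<exists>i::nat. i < 2 ^ v \<and> (\<forall>k<v. bit i k = U k)"
proof -
  let ?i = "horner_sum of_bool 2 (map U [0..<v]) :: nat"
  have "?i < 2 ^ v"
    using horner_sum_of_bool_2_less[of "map U [0..<v]"] by simp
  moreover have "\<forall>k<v. bit ?i k = U k"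
    by (simp add: bit_horner_sum_bit_iff)
  ultimately show ?thesis by blast
qed

lemma peval_bool_minterm [simp]:
  "peval U W (bool_minterm v i) \<longleftrightarrow> (\<forall>k<v. U k = bit i k)"
  by (auto simp: bool_minterm_def simp del: if_image_distrib)

lemma holds_bool_minterm [simp]:
  "holds R V w (bool_minterm v i) \<longleftrightarrow> (\<forall>k<v. V w k = bit i k)"
  by (auto simp: bool_minterm_def simp del: if_image_distrib)

lemma vars_simps [simp]:
  "vars (Neg \<phi>) = vars \<phi>" "vars (And \<phi> \<psi>) = vars \<phi> \<union> vars \<psi>" "vars (Dia \<phi>) = vars \<phi>"
  "vars (BigAnd \<phi>s) = (\<Union>\<phi>\<in>set \<phi>s. vars \<phi>)"
  by (induction \<phi>s) (auto simp: Neg_def And_def Dia_def BigAnd_def Top_def)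

lemma mdeg_simps [simp]:
  "mdeg (Neg \<phi>) = mdeg \<phi>" "mdeg (And \<phi> \<psi>) = max (mdeg \<phi>) (mdeg \<psi>)"
  "mdeg (Dia \<phi>) = Suc (mdeg \<phi>)"
  "mdeg (BigAnd \<phi>s) \<le> d \<longleftrightarrow> (\<forall>\<phi>\<in>set \<phi>s. mdeg \<phi> \<le> d)"
  by (induction \<phi>s) (auto simp: Neg_def And_def Dia_def BigAnd_def Top_def)

lemma bool_minterm_in_Fm: "bool_minterm v i \<in> Fm v d"
  by (auto simp: Fm_def bool_minterm_def)

lemma minterm_fm_in_Fm: "minterm_fm v s \<epsilon> \<in> Fm v 1"
  using bool_minterm_in_Fm[of v _ 0] by (auto simp: minterm_fm_def Fm_def)

lemma vars_subst: "vars (subst \<sigma> \<phi>) = (\<Union>k\<in>vars \<phi>. vars (\<sigma> k))"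
  by (induction \<phi>) auto

lemma mdeg_subst_bool: "(\<And>k. mdeg (\<sigma> k) = 0) \<Longrightarrow> mdeg (subst \<sigma> \<phi>) = mdeg \<phi>"
  by (induction \<phi>) auto

text \<open>\<open>\<sigma> k\<close> is the disjunctive normal form of the Boolean function sending
  \<open>j\<close> to the \<open>k\<close>-th digit of \<open>f j\<close>, with the disjunction
  written as a negated conjunction of negations.\<close>

lemma ex_subst_for_map:
  fixes f :: "nat \<Rightarrow> nat"
  obtains \<sigma> where "\<And>k. \<sigma> k \<in> Fm v 0"
    and "\<And>j k W. j < 2 ^ v \<Longrightarrow> peval (bit j) W (\<sigma> k) = bit (f j) k"
proof
  let ?\<sigma> = "\<lambda>k. Neg (BigAnd (map (\<lambda>j. Neg (bool_minterm v j))
                                (filter (\<lambda>j. bit (f j) k) [0..<2 ^ v])))"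
  show "?\<sigma> k \<in> Fm v 0" for k
    using bool_minterm_in_Fm[of v _ 0] mdeg_simps(4)[where d = 0] by (auto simp: Fm_def)
  show "peval (bit j) W (?\<sigma> k) = bit (f j) k" if "j < 2 ^ v" for j k W
    using that bits_eq_iff[OF that] by auto
qed

section \<open>The model of a minterm\<close>

text \<open>The root is \<open>None\<close> and \<open>Some i\<close> is a dead end with valuation
  \<open>i\<close>. Keeping the root apart from the leaf of the same valuation makes the root
  valuation independent of the set of visible leaves.\<close>

abbreviation depth1_rel :: "nat \<Rightarrow> (nat \<Rightarrow> bool) \<Rightarrow> nat option \<Rightarrow> nat option \<Rightarrow> bool" where
  "depth1_rel v \<epsilon> w u \<equiv> w = None \<and> (\<exists>i<2 ^ v. \<epsilon> i \<and> u = Some i)"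

abbreviation depth1_val :: "nat \<Rightarrow> nat option \<Rightarrow> nat \<Rightarrow> bool" where
  "depth1_val s w \<equiv> bit (case w of None \<Rightarrow> s | Some i \<Rightarrow> i)"

definition holds_at_minterm :: "nat \<Rightarrow> nat \<Rightarrow> (nat \<Rightarrow> bool) \<Rightarrow> fm \<Rightarrow> bool" where
  "holds_at_minterm v s \<epsilon> \<phi> \<longleftrightarrow> holds (depth1_rel v \<epsilon>) (depth1_val s) None \<phi>"

lemma minterm_fm_at_minterm: "holds_at_minterm v s \<epsilon> (minterm_fm v s \<epsilon>)"
proof -
  have "(\<exists>u. (\<exists>j<2 ^ v. \<epsilon> j \<and> u = Some j) \<and> (\<forall>k<v. depth1_val s u k = bit i k)) \<longleftrightarrow> \<epsilon> i"
    if "i < 2 ^ v" for i :: nat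
    using bits_eq_iff[OF _ that] that by force
  then show ?thesis
    by (auto simp: holds_at_minterm_def minterm_fm_def simp del: if_image_distrib)
qed

text \<open>A minterm is a complete description up to degree one: its model settles every such
  formula, and \<open>K\<close> derives the verdict. The essential case is \<open>Box\<close>
  applied to a Boolean formula.\<close>

lemma K_minterm_decides:
  assumes "\<phi> \<in> Fm v 1"
  shows "if holds_at_minterm v s \<epsilon> \<phi> then Imp (minterm_fm v s \<epsilon>) \<phi> \<in> K
         else Imp (minterm_fm v s \<epsilon>) (Neg \<phi>) \<in> K"
proof -
  let ?m = "minterm_fm v s \<epsilon>" and ?R = "depth1_rel v \<epsilon>" and ?V = "depth1_val s"
  note K = normal_logic_K
  have m: "peval U W ?m \<longleftrightarrow> (\<forall>k<v. U k = bit s k) \<and>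
             (\<forall>i<2 ^ v. \<epsilon> i \<longleftrightarrow> \<not> W (Neg (bool_minterm v i)))" for U W
    by (auto simp: minterm_fm_def simp del: if_image_distrib split: if_splits)
  from assms have "vars \<phi> \<subseteq> {..<v}" "mdeg \<phi> \<le> 1" by (auto simp: Fm_def)
  then show ?thesis
  proof (induction \<phi>)
    case Bot
    show ?case
      by (auto simp: holds_at_minterm_def intro!: normal_logic_taut[OF K])
  next
    case (Var k)
    then show ?case
      by (auto simp: holds_at_minterm_def m intro!: normal_logic_taut[OF K])
  next
    case (Imp \<phi> \<psi>)
    let ?dec = "\<lambda>\<chi>. Imp ?m (if holds_at_minterm v s \<epsilon> \<chi> then \<chi> else Neg \<chi>)"
    have "?dec \<phi> \<in> K" "?dec \<psi> \<in> K"
      using Imp by (auto split: if_splits)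
    then have "?dec (Imp \<phi> \<psi>) \<in> K"
      by (intro normal_logic_taut_conseq[OF K, of "[?dec \<phi>, ?dec \<psi>]"])
        (auto simp: holds_at_minterm_def split: if_splits)
    then show ?case by (auto split: if_splits)
  next
    case (Box \<phi>)
    then have \<phi>: "mdeg \<phi> = 0" "vars \<phi> \<subseteq> {..<v}" by auto
    have bool: "holds ?R ?V (Some i) \<phi> = peval U W \<phi>" if "\<forall>k<v. U k = bit i k" for i U W
      using that by (intro holds_bool_eq_peval[OF \<phi>]) auto
    show ?case
    proof (cases "holds_at_minterm v s \<epsilon> (Box \<phi>)")
      case True
      then have true: "holds ?R ?V (Some i) \<phi>" if "i < 2 ^ v" "\<epsilon> i" for i
        using that by (auto simp: holds_at_minterm_def)
      \<comment> \<open>A valuation avoiding every invisible Boolean minterm is that of a visible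
        leaf, where \<open>\<phi>\<close> is true. After boxing, the minterm itself supplies all the
        premises.\<close>
      let ?xs = "map (\<lambda>i. Neg (bool_minterm v i)) (filter (\<lambda>i. \<not> \<epsilon> i) [0..<2 ^ v])"
      have "peval U W (foldr Imp ?xs \<phi>)" for U W
      proof -
        obtain i :: nat where "i < 2 ^ v" "\<forall>k<v. U k = bit i k"
          using ex_nat_with_bits[of v U] by metis
        then show ?thesis
          using true[of i] bool[of U i W] by auto
      qed
      then have "foldr Imp ?xs \<phi> \<in> K"
        by (intro normal_logic_taut[OF K]) blast+
      then have "foldr Imp (map Box ?xs) (Box \<phi>) \<in> K"
        by (rule normal_logic_Box_foldr_Imp[OF K])
      then have "Imp ?m (Box \<phi>) \<in> K"
        by (intro normal_logic_taut_conseq[OF K, of "[foldr Imp (map Box ?xs) (Box \<phi>)]"])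
          (auto simp: m)
      with True show ?thesis by simp
    next
      case False
      then obtain i where i: "i < 2 ^ v" "\<epsilon> i" "\<not> holds ?R ?V (Some i) \<phi>"
        by (auto simp: holds_at_minterm_def)
      \<comment> \<open>Leaf \<open>i\<close> refutes \<open>\<phi>\<close>, so
        \<open>\<phi>\<close> tautologically implies \<open>?n\<close>. Then
        \<open>Box \<phi>\<close> yields \<open>Box ?n\<close>, against the conjunct of the minterm
        saying that \<open>i\<close> is visible.\<close>
      let ?n = "Neg (bool_minterm v i)"
      have "foldr Imp [\<phi>] ?n \<in> K"
        using bool[where i = i] i(3)
        by (intro normal_logic_taut[OF K])
          (simp only: foldr.simps o_apply id_apply peval.simps peval_simps peval_bool_minterm, blast)
      then have "Imp (Box \<phi>) (Box ?n) \<in> K"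
        using normal_logic_Box_foldr_Imp[OF K, of "[\<phi>]"] by simp
      then have "Imp ?m (Neg (Box \<phi>)) \<in> K"
        using i(1,2)
        by (intro normal_logic_taut_conseq[OF K, of "[Imp (Box \<phi>) (Box ?n)]"]) (auto simp: m)
      with False show ?thesis by simp
    qed
  qed
qed

lemma K_minterm_imp_iff:
  assumes "\<phi> \<in> Fm v 1"
  shows "Imp (minterm_fm v s \<epsilon>) \<phi> \<in> K \<longleftrightarrow> holds_at_minterm v s \<epsilon> \<phi>"
proof
  assume "Imp (minterm_fm v s \<epsilon>) \<phi> \<in> K"
  then have "holds_at_minterm v s \<epsilon> (Imp (minterm_fm v s \<epsilon>) \<phi>)"
    unfolding holds_at_minterm_def by (rule K_sound)
  with minterm_fm_at_minterm[of v s \<epsilon>] show "holds_at_minterm v s \<epsilon> \<phi>"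
    by (simp add: holds_at_minterm_def)
next
  assume "holds_at_minterm v s \<epsilon> \<phi>"
  with K_minterm_decides[OF assms, of s \<epsilon>] show "Imp (minterm_fm v s \<epsilon>) \<phi> \<in> K"
    by simp
qed

text \<open>This removes the quotient algebra: from here on, membership in a characteristic
  minmatrix is a question about truth at the root of one model.\<close>

lemma minterm_in_char_minmatrix_iff:
  assumes S: "normal_logic S" and "s < 2 ^ v"
  shows "minterm v s \<epsilon> \<in> char_minmatrix v S \<longleftrightarrow>
    (\<forall>\<phi>\<in>Fm v 1 \<inter> S. holds_at_minterm v s \<epsilon> \<phi>)" (is "?L \<longleftrightarrow> ?R")
proof
  note K = normal_logic_K
  have self: "\<phi> \<in> K_equiv v 1 `` {\<phi>}" if "\<phi> \<in> Fm v 1" for \<phi>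
    using that by (auto simp: K_equiv_def intro!: normal_logic_taut[OF K])
  {
    assume L: ?L
    show ?R
    proof
      fix \<phi> assume \<phi>: "\<phi> \<in> Fm v 1 \<inter> S"
      let ?a = "K_equiv v 1 `` {\<phi>}"
      have "?a \<in> K_alg v 1" "provable S ?a"
        using \<phi> self[of \<phi>] by (auto simp: K_alg_def provable_def quotientI)
      with L have "alg_le (minterm v s \<epsilon>) ?a"
        by (auto simp: char_minmatrix_def minset_def)
      \<comment> \<open>The order is witnessed by arbitrary representatives, which are exchanged for
        the original formulas through their equivalences in \<open>K\<close>.\<close>
      then obtain \<mu> \<psi> where *: "Iff (minterm_fm v s \<epsilon>) \<mu> \<in> K" "Iff \<phi> \<psi> \<in> K" "Imp \<mu> \<psi> \<in> K"
        by (auto simp: alg_le_def minterm_def K_equiv_def)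
      then have "Imp (minterm_fm v s \<epsilon>) \<phi> \<in> K"
        by (intro normal_logic_taut_conseq[OF K,
              of "[Iff (minterm_fm v s \<epsilon>) \<mu>, Iff \<phi> \<psi>, Imp \<mu> \<psi>]"]) auto
      with \<phi> show "holds_at_minterm v s \<epsilon> \<phi>"
        by (simp add: K_minterm_imp_iff)
    qed
  }
  assume R: ?R
  have "minterm v s \<epsilon> \<in> minset v a" if a: "a \<in> K_alg v 1" "provable S a" for a
  proof -
    obtain \<phi> where \<phi>: "\<phi> \<in> a" "\<phi> \<in> S"
      using a(2) by (auto simp: provable_def)
    then have "\<phi> \<in> Fm v 1"
      using a(1) by (auto simp: K_alg_def quotient_def K_equiv_def)
    with R \<phi> have "Imp (minterm_fm v s \<epsilon>) \<phi> \<in> K"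
      by (simp add: K_minterm_imp_iff)
    then have "alg_le (minterm v s \<epsilon>) a"
      using \<phi>(1) self[OF minterm_fm_in_Fm] by (auto simp: alg_le_def minterm_def)
    with \<open>s < 2 ^ v\<close> show ?thesis
      by (auto simp: minset_def minterms_def)
  qed
  then show ?L by (auto simp: char_minmatrix_def)
qed

text \<open>\<open>Top\<close> is a theorem of every normal logic, so the intersection runs over a
  nonempty family and is not the whole universe.\<close>

lemma char_minmatrix_subset_minterms:
  assumes "normal_logic S"
  shows "char_minmatrix v S \<subseteq> minterms v"
proof -
  have "Top \<in> S"
    by (rule normal_logic_taut[OF assms]) (auto simp: Top_def)
  moreover have "Top \<in> Fm v 1"
    by (auto simp: Fm_def Top_def)
  moreover from this have "Top \<in> K_equiv v 1 `` {Top}"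
    by (auto simp: K_equiv_def intro!: normal_logic_taut[OF normal_logic_K])
  ultimately have "K_equiv v 1 `` {Top} \<in> K_alg v 1" "provable S (K_equiv v 1 `` {Top})"
    by (auto simp: K_alg_def provable_def quotientI)
  then show ?thesis
    by (auto simp: char_minmatrix_def minset_def)
qed

section \<open>Closure under maps of valuations\<close>

abbreviation successors :: "nat \<Rightarrow> (nat \<Rightarrow> bool) \<Rightarrow> nat set" where
  "successors v \<epsilon> \<equiv> {i. i < 2 ^ v \<and> \<epsilon> i}"

text \<open>A Boolean substitution keeps theorems of \<open>S\<close> within \<open>Fm v 1\<close>.
  Evaluating \<open>subst \<sigma> \<phi>\<close> in the old model relabels its worlds by
  \<open>f\<close>, and merging equally labelled leaves does not affect formulas of degree at most
  one.\<close>

lemma char_minmatrix_closed_under_map: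
  assumes S: "normal_logic S"
    and mem: "minterm v s' \<epsilon>' \<in> char_minmatrix v S"
    and bounds: "s' < 2 ^ v" "s < 2 ^ v"
    and f: "f s' = s" "f ` successors v \<epsilon>' = successors v \<epsilon>"
  shows "minterm v s \<epsilon> \<in> char_minmatrix v S"
proof -
  obtain \<sigma> where \<sigma>: "\<And>k. \<sigma> k \<in> Fm v 0"
    and \<sigma>_val: "\<And>j k W. j < 2 ^ v \<Longrightarrow> peval (bit j) W (\<sigma> k) = bit (f j) k"
    using ex_subst_for_map[of v f] by metis
  let ?R = "depth1_rel v \<epsilon>'" and ?V = "depth1_val s'"
  \<comment> \<open>The old frame with relabelled worlds: the root now carries \<open>s\<close> and
    each leaf \<open>i\<close> carries \<open>f i\<close>.\<close>
  define V where "V = (\<lambda>u k. holds ?R ?V u (\<sigma> k))"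
  have V: "V None = bit s" "\<And>i. i < 2 ^ v \<Longrightarrow> V (Some i) = bit (f i)"
    using \<sigma> \<sigma>_val bounds f(1)
    by (auto simp: V_def Fm_def fun_eq_iff holds_eq_peval[of _ _ _ "\<sigma> _"])
  have "holds_at_minterm v s \<epsilon> \<phi>" if \<phi>: "\<phi> \<in> Fm v 1 \<inter> S" for \<phi>
  proof -
    have "subst \<sigma> \<phi> \<in> Fm v 1 \<inter> S"
      using \<phi> \<sigma> S by (auto simp: Fm_def vars_subst mdeg_subst_bool normal_logic_def)
    then have "holds ?R ?V None (subst \<sigma> \<phi>)"
      using mem minterm_in_char_minmatrix_iff[OF S bounds(1)] by (simp add: holds_at_minterm_def)
    then have "holds ?R V None \<phi>"
      by (simp add: holds_subst V_def)
    moreover have "holds ?R V None \<phi> = holds_at_minterm v s \<epsilon> \<phi>" if "mdeg \<phi> \<le> 1"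
      using that
    proof (induction \<phi>)
      case (Box \<psi>)
      \<comment> \<open>\<open>\<psi>\<close> is Boolean, so both sides equal its propositional
        value at \<open>bit (f i)\<close>. The constant \<open>True\<close> is a dummy value for
        boxed formulas, none of which occurs in \<open>\<psi>\<close>.\<close>
      have eq: "holds ?R V (Some i) \<psi> = holds (depth1_rel v \<epsilon>) (depth1_val s) (Some (f i)) \<psi>"
        if "i < 2 ^ v" for i
        using Box V(2)[OF that]
          holds_bool_eq_peval[of \<psi> UNIV V "Some i" "bit (f i)" _ "\<lambda>_. True"]
          holds_bool_eq_peval[of \<psi> UNIV "depth1_val s" "Some (f i)" "bit (f i)" _ "\<lambda>_. True"]
        by simp
      have "holds ?R V None (Box \<psi>) \<longleftrightarrow> (\<forall>i\<in>successors v \<epsilon>'. holds ?R V (Some i) \<psi>)"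
        by auto
      also have "\<dots> \<longleftrightarrow> (\<forall>i\<in>f ` successors v \<epsilon>'.
                        holds (depth1_rel v \<epsilon>) (depth1_val s) (Some i) \<psi>)"
        using eq by auto
      also have "\<dots> \<longleftrightarrow> holds_at_minterm v s \<epsilon> (Box \<psi>)"
        unfolding f(2) by (auto simp: holds_at_minterm_def)
      finally show ?case .
    qed (auto simp: holds_at_minterm_def V(1))
    ultimately show ?thesis
      using \<phi> by (auto simp: Fm_def)
  qed
  then show ?thesis
    using minterm_in_char_minmatrix_iff[OF S bounds(2)] by blast
qed

text \<open>Invert an injection of \<open>B\<close> into \<open>A\<close> on its range and send the
  remaining points of \<open>A\<close> to a fixed element of \<open>B\<close>.\<close>

lemma ex_image_eq:
  assumes "finite A" "finite B" "B \<noteq> {}" "card B \<le> card A"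
  shows "\<exists>g. g ` A = B"
proof -
  obtain h where h: "h ` B \<subseteq> A" "inj_on h B"
    using assms card_le_inj[of B A] by blast
  obtain b where "b \<in> B" using assms(3) by blast
  have "(\<lambda>a. if a \<in> h ` B then the_inv_into B h a else b) ` A = B" (is "?g ` A = B")
  proof
    show "?g ` A \<subseteq> B"
      using \<open>b \<in> B\<close> the_inv_into_into[OF h(2)] by auto
    show "B \<subseteq> ?g ` A"
      using h the_inv_into_f_f[OF h(2)] by force
  qed
  then show ?thesis by blast
qed

section \<open>The diagonal rules\<close>

text \<open>This lets the rules treat \<open>Dd0\<close> as the case \<open>l = 0\<close> of the
  family \<open>Dw\<close>.\<close>

lemma Dd0_eq_Dw_0: "Dd0 v = Dw v 0"
  by (auto simp: Dd0_def Dw_def)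

lemma Dw_subsetI:
  assumes "\<And>s \<epsilon>. s < 2 ^ v \<Longrightarrow> \<epsilon> s \<Longrightarrow> card {i. i < 2 ^ v \<and> i \<noteq> s \<and> \<epsilon> i} = k
             \<Longrightarrow> minterm v s \<epsilon> \<in> X"
  shows "Dw v k \<subseteq> X"
proof
  fix m assume "m \<in> Dw v k"
  then obtain s \<epsilon> where "m = minterm v s \<epsilon>" and s: "s < 2 ^ v" "\<epsilon> s" "card {i. i < 2 ^ v \<and> i \<noteq> s \<and> \<epsilon> i} = k"
    unfolding Dw_def mem_Collect_eq by (elim exE conjE)
  then show "m \<in> X" using assms[OF s] by (simp only:)
qed

lemma Dc_subsetI:
  assumes "\<And>s \<epsilon>. s < 2 ^ v \<Longrightarrow> \<not> \<epsilon> s \<Longrightarrow> card {i. i < 2 ^ v \<and> i \<noteq> s \<and> \<epsilon> i} = k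
             \<Longrightarrow> minterm v s \<epsilon> \<in> X"
  shows "Dc v k \<subseteq> X"
proof
  fix m assume "m \<in> Dc v k"
  then obtain s \<epsilon> where "m = minterm v s \<epsilon>" and s: "s < 2 ^ v" "\<not> \<epsilon> s" "card {i. i < 2 ^ v \<and> i \<noteq> s \<and> \<epsilon> i} = k"
    unfolding Dc_def mem_Collect_eq by (elim exE conjE)
  then show "m \<in> X" using assms[OF s] by (simp only:)
qed

lemma successors_Dw:
  assumes "s < 2 ^ v" "\<epsilon> s"
  shows "successors v \<epsilon> = insert s {i. i < 2 ^ v \<and> i \<noteq> s \<and> \<epsilon> i}"
  using assms by auto

lemma successors_Dc:
  assumes "\<not> \<epsilon> s"
  shows "successors v \<epsilon> = {i. i < 2 ^ v \<and> i \<noteq> s \<and> \<epsilon> i}"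
  using assms by auto

text \<open>Both roots see their own valuation, so it suffices to send \<open>s'\<close> to
  \<open>s\<close> and to map the other visible valuations \<open>?E'\<close> onto
  \<open>?E\<close>. A single member of the minmatrix suffices.\<close>

lemma Dw_subset_if_member_Dw:
  assumes "normal_logic S" "minterm v s' \<epsilon>' \<in> char_minmatrix v S"
    and s': "s' < 2 ^ v" "\<epsilon>' s'" "l \<le> card {i. i < 2 ^ v \<and> i \<noteq> s' \<and> \<epsilon>' i}" (is "l \<le> card ?E'")
  shows "Dw v l \<subseteq> char_minmatrix v S"
proof (rule Dw_subsetI)
  fix s :: nat and \<epsilon>
  assume s: "s < 2 ^ v" "\<epsilon> s" "card {i. i < 2 ^ v \<and> i \<noteq> s \<and> \<epsilon> i} = l" (is "card ?E = l")
  note closed = char_minmatrix_closed_under_map[OF assms(1,2) s'(1) s(1)]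
  note successors = successors_Dw[of s v \<epsilon>, OF s(1,2)] successors_Dw[of s' v \<epsilon>', OF s'(1,2)]
  show "minterm v s \<epsilon> \<in> char_minmatrix v S"
  \<comment> \<open>With \<open>?E\<close> empty, no map of a nonempty \<open>?E'\<close> has image
    \<open>?E\<close>; the constant map to \<open>s\<close> then does the job.\<close>
  proof (cases "?E = {}")
    case True
    then have "(\<lambda>_. s) ` successors v \<epsilon>' = successors v \<epsilon>"
      unfolding successors by auto
    then show ?thesis by (rule closed[rotated]) simp
  next
    case False
    then obtain g where "g ` ?E' = ?E"
      using ex_image_eq[of ?E' ?E] s(3) s'(3) by auto
    \<comment> \<open>Redefining \<open>g\<close> at \<open>s'\<close> is harmless, since
      \<open>s'\<close> is outside \<open>?E'\<close>.\<close>
    moreover have "(g(s' := s)) ` ?E' = g ` ?E'"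
      by (intro image_cong) auto
    ultimately have "(g(s' := s)) ` insert s' ?E' = insert s ?E"
      unfolding image_insert by simp
    then have "(g(s' := s)) ` successors v \<epsilon>' = successors v \<epsilon>"
      unfolding successors .
    then show ?thesis by (rule closed[rotated]) simp
  qed
qed

text \<open>The root valuation \<open>s'\<close> is not visible, so its image can be chosen
  independently of the images of the visible ones. Hence every root with a nonempty visible set of
  size at most \<open>k\<close> is reached.\<close>

lemma subset_if_member_Dc:
  assumes "normal_logic S" "minterm v s' \<epsilon>' \<in> char_minmatrix v S"
    and s': "s' < 2 ^ v" "\<not> \<epsilon>' s'" "card {i. i < 2 ^ v \<and> i \<noteq> s' \<and> \<epsilon>' i} = k"
  shows "l < k \<Longrightarrow> Dw v l \<subseteq> char_minmatrix v S"
    and "1 \<le> l \<Longrightarrow> l \<le> k \<Longrightarrow> Dc v l \<subseteq> char_minmatrix v S"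
proof -
  have *: "minterm v s \<epsilon> \<in> char_minmatrix v S"
    if s: "s < 2 ^ v" "successors v \<epsilon> \<noteq> {}" "card (successors v \<epsilon>) \<le> k" for s \<epsilon>
  proof -
    obtain g where "g ` successors v \<epsilon>' = successors v \<epsilon>"
      using ex_image_eq[of "successors v \<epsilon>'" "successors v \<epsilon>"] s s'
      unfolding successors_Dc[of \<epsilon>' s', OF s'(2)] by auto
    moreover have "(g(s' := s)) ` successors v \<epsilon>' = g ` successors v \<epsilon>'"
      using s'(2) by (intro image_cong) auto
    ultimately have "(g(s' := s)) ` successors v \<epsilon>' = successors v \<epsilon>" by simp
    then show ?thesis
      by (rule char_minmatrix_closed_under_map[OF assms(1,2) s'(1) s(1), rotated]) simp
  qed
  show "Dw v l \<subseteq> char_minmatrix v S" if "l < k"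
  proof (rule Dw_subsetI)
    fix s :: nat and \<epsilon>
    assume s: "s < 2 ^ v" "\<epsilon> s" "card {i. i < 2 ^ v \<and> i \<noteq> s \<and> \<epsilon> i} = l"
    show "minterm v s \<epsilon> \<in> char_minmatrix v S"
    proof (rule *)
      \<comment> \<open>Here \<open>s\<close> itself is visible too, making \<open>l + 1\<close>
        successors; this is why the bound for \<open>Dw\<close> is strict and that for
        \<open>Dc\<close> is not.\<close>
      show "card (successors v \<epsilon>) \<le> k"
        using s \<open>l < k\<close> unfolding successors_Dw[of s v \<epsilon>, OF s(1,2)] by simp
    qed (use s in auto)
  qed
  show "Dc v l \<subseteq> char_minmatrix v S" if "1 \<le> l" "l \<le> k"
  proof (rule Dc_subsetI)
    fix s :: nat and \<epsilon>
    assume s: "s < 2 ^ v" "\<not> \<epsilon> s" "card {i. i < 2 ^ v \<and> i \<noteq> s \<and> \<epsilon> i} = l"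
    have card: "card (successors v \<epsilon>) = l"
      using s(3) unfolding successors_Dc[of \<epsilon> s, OF s(2)] .
    with \<open>1 \<le> l\<close> have "successors v \<epsilon> \<noteq> {}"
      by (metis card.empty not_one_le_zero)
    with card s(1) \<open>l \<le> k\<close> show "minterm v s \<epsilon> \<in> char_minmatrix v S"
      by (intro *) simp_all
  qed
qed

text \<open>For \<open>k\<close> below \<open>2 ^ v\<close> the inclusion of \<open>Dw v k\<close>
  in a minmatrix is not vacuous: take root 0 seeing \<open>0, ..., k\<close>.\<close>

lemma Dw_nonempty:
  assumes "k < 2 ^ v"
  obtains s \<epsilon> where "minterm v s \<epsilon> \<in> Dw v k"
    and "s < 2 ^ v" "\<epsilon> s" "card {i. i < 2 ^ v \<and> i \<noteq> s \<and> \<epsilon> i} = k"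
proof -
  let ?\<epsilon> = "\<lambda>i. i \<le> k"
  have "{i. i < 2 ^ v \<and> i \<noteq> 0 \<and> ?\<epsilon> i} = {1..k}" using assms by auto
  then have "card {i. i < 2 ^ v \<and> i \<noteq> 0 \<and> ?\<epsilon> i} = k" by simp
  moreover from this have "minterm v 0 ?\<epsilon> \<in> Dw v k"
    unfolding Dw_def mem_Collect_eq by (intro exI[of _ 0] exI[of _ ?\<epsilon>]) simp
  ultimately show thesis by (intro that[of 0 ?\<epsilon>]) simp_all
qed

text \<open>As for \<open>Dw\<close>, but root 0 sees only \<open>1, ..., k\<close>.\<close>

lemma Dc_nonempty:
  assumes "k < 2 ^ v"
  obtains s \<epsilon> where "minterm v s \<epsilon> \<in> Dc v k"
    and "s < 2 ^ v" "\<not> \<epsilon> s" "card {i. i < 2 ^ v \<and> i \<noteq> s \<and> \<epsilon> i} = k"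
proof -
  let ?\<epsilon> = "\<lambda>i. 1 \<le> i \<and> i \<le> k"
  have "{i. i < 2 ^ v \<and> i \<noteq> 0 \<and> ?\<epsilon> i} = {1..k}" using assms by auto
  then have "card {i. i < 2 ^ v \<and> i \<noteq> 0 \<and> ?\<epsilon> i} = k" by simp
  moreover from this have "minterm v 0 ?\<epsilon> \<in> Dc v k"
    unfolding Dc_def mem_Collect_eq by (intro exI[of _ 0] exI[of _ ?\<epsilon>]) simp
  ultimately show thesis by (intro that[of 0 ?\<epsilon>]) simp_all
qed

theorem theorem10:
  fixes v n :: nat and \<xi> :: "fm set set"
  assumes "v \<ge> 1"
    and "n = 2 ^ v"
    and "\<xi> \<in> char_minmatrices v"
    and "\<xi> \<noteq> {}"
  shows "(Vv0 v \<subseteq> \<xi> \<or> Dd0 v \<subseteq> \<xi>)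
    \<and> (\<forall>k. 1 \<le> k \<and> k < n \<longrightarrow> Dw v k \<subseteq> \<xi> \<longrightarrow>
          Dd0 v \<subseteq> \<xi> \<and> (\<forall>l. 1 \<le> l \<and> l < k \<longrightarrow> Dw v l \<subseteq> \<xi>))
    \<and> (\<forall>k. 1 \<le> k \<and> k < n \<longrightarrow> Dc v k \<subseteq> \<xi> \<longrightarrow>
          Dd0 v \<subseteq> \<xi> \<and> (\<forall>l. 1 \<le> l \<and> l < k \<longrightarrow> Dw v l \<subseteq> \<xi>)
                  \<and> (\<forall>l. 1 \<le> l \<and> l < k \<longrightarrow> Dc v l \<subseteq> \<xi>))"
proof -
  obtain S where S: "normal_logic S" and \<xi>: "\<xi> = char_minmatrix v S"
    using assms(3) by (auto simp: char_minmatrices_def)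
  obtain s' \<epsilon>' where s': "s' < 2 ^ v" "minterm v s' \<epsilon>' \<in> char_minmatrix v S"
    using assms(4) char_minmatrix_subset_minterms[OF S, of v] unfolding \<xi> minterms_def by blast
  \<comment> \<open>Constant maps suffice for the first rule: they send an empty visible set to the
    empty set, giving \<open>Vv0\<close>, and a nonempty one to \<open>{s}\<close>, giving
    \<open>Dd0\<close>.\<close>
  note closed = char_minmatrix_closed_under_map[OF S s'(2,1), where f = "\<lambda>_. _"]
  have DR1: "Vv0 v \<subseteq> \<xi> \<or> Dd0 v \<subseteq> \<xi>"
  proof (cases "successors v \<epsilon>' = {}")
    case True
    have "minterm v s \<epsilon> \<in> \<xi>" if "s < 2 ^ v" "\<forall>i<2 ^ v. \<not> \<epsilon> i" for s \<epsilon>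
      unfolding \<xi> by (rule closed) (use that True in auto)
    then show ?thesis by (auto simp: Vv0_def)
  next
    case False
    have "minterm v s \<epsilon> \<in> \<xi>"
      if "s < 2 ^ v" "\<epsilon> s" "\<forall>i<2 ^ v. i \<noteq> s \<longrightarrow> \<not> \<epsilon> i" for s \<epsilon>
      unfolding \<xi> by (rule closed) (use that False in auto)
    then show ?thesis by (auto simp: Dd0_def)
  qed
  \<comment> \<open>The value \<open>l = 0\<close> is deliberately allowed: since
    \<open>1 \<le> k\<close>, it yields the inclusion of \<open>Dd0\<close> in the second
    rule.\<close>
  have Dw: "Dw v l \<subseteq> \<xi>" if k: "k < n" "Dw v k \<subseteq> \<xi>" "l < k" for k l
  proof -
    obtain s \<epsilon> where "minterm v s \<epsilon> \<in> Dw v k"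
      and s: "s < 2 ^ v" "\<epsilon> s" "card {i. i < 2 ^ v \<and> i \<noteq> s \<and> \<epsilon> i} = k"
      using k(1) unfolding assms(2) by (rule Dw_nonempty)
    then have "minterm v s \<epsilon> \<in> char_minmatrix v S"
      using k(2) \<xi> by (simp only: subset_iff)
    from Dw_subset_if_member_Dw[OF S this s(1,2)] show ?thesis
      using s(3) k(3) \<xi> by simp
  qed
  have Dc: "Dw v l \<subseteq> \<xi> \<and> (1 \<le> l \<longrightarrow> Dc v l \<subseteq> \<xi>)"
    if k: "k < n" "Dc v k \<subseteq> \<xi>" "l < k" for k l
  proof -
    obtain s \<epsilon> where "minterm v s \<epsilon> \<in> Dc v k"
      and s: "s < 2 ^ v" "\<not> \<epsilon> s" "card {i. i < 2 ^ v \<and> i \<noteq> s \<and> \<epsilon> i} = k"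
      using k(1) unfolding assms(2) by (rule Dc_nonempty)
    then have "minterm v s \<epsilon> \<in> char_minmatrix v S"
      using k(2) \<xi> by (simp only: subset_iff)
    from subset_if_member_Dc[OF S this s] show ?thesis
      using k(3) \<xi> by simp
  qed
  have DR2: "Dd0 v \<subseteq> \<xi> \<and> (\<forall>l. 1 \<le> l \<and> l < k \<longrightarrow> Dw v l \<subseteq> \<xi>)"
    if "1 \<le> k" "k < n" "Dw v k \<subseteq> \<xi>" for k
    unfolding Dd0_eq_Dw_0 using Dw[OF that(2,3)] that(1) by simp
  have DR3: "Dd0 v \<subseteq> \<xi> \<and> (\<forall>l. 1 \<le> l \<and> l < k \<longrightarrow> Dw v l \<subseteq> \<xi>)
                  \<and> (\<forall>l. 1 \<le> l \<and> l < k \<longrightarrow> Dc v l \<subseteq> \<xi>)"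
    if "1 \<le> k" "k < n" "Dc v k \<subseteq> \<xi>" for k
    unfolding Dd0_eq_Dw_0 using Dc[OF that(2,3)] that(1) by simp
  show ?thesis
    by (rule conjI[OF DR1], rule conjI; intro allI impI; elim conjE; rule DR2 DR3; assumption)
qed

end
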